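(* Let $\lambda_B$ be the main eigenvalue of the random Ruelle operator $\mathscr{L}_{B_{t(\cdot)}}$, let $h_B$ be its positive continuous eigenfunction, and let $\{X_s:0\le s\le1\}$ be the process with paths in $\mathscr{D}[0,1]$ determined by $\Theta(X_{(\cdot)})=h_B$. Then almost surely $$\lambda_B=1+\exp(B_{\frac12})\,\frac{X_{\frac12}}{X_0}.$$
   Context: Let $\Omega=\{0,1\}^{\mathbb{N}}$ with $\mathbb{N}=\{1,2,\ldots\}$, a compact metric space with the metric $d(x,y)=2^{-N}$, $N=\inf\{i\in\mathbb{N}: x_i\neq y_i\}$. $C(\Omega)$ is the space of real continuous functions on $\Omega$ with the supremum norm. For $f\in C(\Omega)$ the Ruelle operator $\mathscr{L}_f:C(\Omega)\to C(\Omega)$ is $\mathscr{L}_f(\varphi)(x)=\sum_{a=0,1}\exp(f(ax))\varphi(ax)$, where $ax=(a,x_1,x_2,\ldots)$. Define $t:\Omega\to[0,1]$ by $t(x)=\sum_{n\ge1}2^{-n}x_n$. Let $\{B_s:s\in[0,1]\}$ be a standard one-dimensional Brownian motion (with $B_0=0$ and almost surely continuous paths) on a complete probability space. The Brownian potential is the random function $x\mapsto B_{t(x)}$ on $\Omega$; it is almost surely $\gamma$-Hölder continuous for every $0<\gamma<1/2$. By the Ruelle–Perron–Frobenius theorem for Hölder potentials, almost surely the spectral radius $\lambda_B$ of $\mathscr{L}_{B_{t(\cdot)}}$ is an eigenvalue (the main eigenvalue) of geometric multiplicity one, with a strictly positive continuous eigenfunction $h_B$ given by $h_B(x)=\lim_{n\to\infty}\lambda_B^{-n}\mathscr{L}^n_{B_{t(\cdot)}}(1)(x)$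 (uniform limit). Let $\mathscr{D}=\{s\in[0,1]:\#t^{-1}(s)=2\}$ and let $\prec_{\mathrm{Lex}}$ be the strict lexicographic order on $\Omega$. $\mathscr{D}[0,1]$ is the set of $F:[0,1]\to\mathbb{R}$ continuous at every point of $[0,1]\setminus\mathscr{D}$ and such that for each $t\in\mathscr{D}$ the left limit $\lim_{s\uparrow t}F(s)$ exists and $\lim_{s\downarrow t}F(s)=F(t)$. The linear bijection $\Theta:\mathscr{D}[0,1]\to C(\Omega)$ sends $F$ to the function $f$ with $f(x)=F(t(x))$ if $t(x)\notin\mathscr{D}$, and, if $t(x)=t(y)\in\mathscr{D}$ with $x\prec_{\mathrm{Lex}}y$, $f(x)=\lim_{s\uparrow t(x)}F(s)$ and $f(y)=F(t(y))$. *)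

theory Defs
  imports "HOL-Probability.Probability" "HOL-Library.Fun_Lexorder"
begin

section \<open>The symbolic space\<close>

text \<open>
  A point \<open>(x_1, x_2, ...)\<close> of \<open>{0,1}^\<nat>\<close> is a function \<open>x :: nat \<Rightarrow> bool\<close> with \<open>x n\<close>
  the digit \<open>x_(n+1)\<close>. Its topology is the library's product topology on function types, which
  is the topology of the metric \<open>symb_dist\<close> (lemma \<open>open_symb_iff_dist\<close>). Hence
  \<open>symb \<Rightarrow>\<^sub>C real\<close> is the space of all real continuous functions with the supremum norm
  (lemma \<open>continuous_imp_bcontfun\<close>).
\<close>

type_synonym symb = "nat \<Rightarrow> bool"

definition symb_dist :: "symb \<Rightarrow> symb \<Rightarrow> real" where
  "symb_dist x y = (if x = y then 0 else (1/2) ^ Suc (LEAST i. x i \<noteq> y i))"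

lemma symb_dist_less_iff:
  "symb_dist x y < (1/2) ^ n \<longleftrightarrow> (\<forall>i<n. x i = y i)"
proof (cases "x = y")
  case True
  then show ?thesis by (simp add: symb_dist_def)
next
  case False
  define k where "k = (LEAST i. x i \<noteq> y i)"
  from False have "\<exists>i. x i \<noteq> y i" by auto
  then have k: "x k \<noteq> y k" "\<And>i. i < k \<Longrightarrow> x i = y i"
    unfolding k_def by (rule LeastI_ex) (use not_less_Least in blast)
  have "symb_dist x y < (1/2) ^ n \<longleftrightarrow> n < Suc k"
    using False unfolding symb_dist_def k_def[symmetric]
    by (simp add: power_strict_decreasing_iff del: power_Suc)
  also have "\<dots> \<longleftrightarrow> (\<forall>i<n. x i = y i)"
    using k by (metis less_Suc_eq_le not_less order_less_le_trans)
  finally show ?thesis .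
qed

lemma open_symb_cylinder: "open {y :: symb. \<forall>i<n. x i = y i}"
proof -
  have "open (\<Pi>\<^sub>E i\<in>UNIV. if i < n then {x i} else UNIV)"
    by (rule open_PiE) (auto intro: Topological_Spaces.open_discrete)
  also have "(\<Pi>\<^sub>E i\<in>UNIV. if i < n then {x i} else UNIV) = {y. \<forall>i<n. x i = y i}"
    by (auto simp: PiE_iff split: if_splits)
  finally show ?thesis .
qed

lemma open_symb_iff_dist:
  "open (U :: symb set) \<longleftrightarrow> (\<forall>x\<in>U. \<exists>e>0. \<forall>y. symb_dist x y < e \<longrightarrow> y \<in> U)"
proof
  assume U: "open U"
  show "\<forall>x\<in>U. \<exists>e>0. \<forall>y. symb_dist x y < e \<longrightarrow> y \<in> U"
  proof
    fix x assume "x \<in> U"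
    then obtain X where X: "x \<in> (\<Pi>\<^sub>E i\<in>UNIV. X i)" "finite {i. X i \<noteq> UNIV}"
        "(\<Pi>\<^sub>E i\<in>UNIV. X i) \<subseteq> U"
      using product_topology_open_contains_basis[of "\<lambda>_. euclidean" UNIV U x] U
      by (auto simp: euclidean_product_topology)
    from X(2) obtain n where n: "\<And>i. X i \<noteq> UNIV \<Longrightarrow> i < n"
      by (auto simp: finite_nat_set_iff_bounded)
    have "y \<in> U" if "symb_dist x y < (1/2) ^ n" for y
    proof -
      have "y i \<in> X i" for i
      proof (cases "X i = UNIV")
        case False
        then have "x i = y i" using n that by (simp add: symb_dist_less_iff)
        moreover have "x i \<in> X i" using X(1) by (rule PiE_mem) simp
        ultimately show ?thesis by (simp only:)
      qed simp
      then show ?thesis using X(3) by (auto simp: PiE_iff)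
    qed
    then show "\<exists>e>0. \<forall>y. symb_dist x y < e \<longrightarrow> y \<in> U"
      by (intro exI[of _ "(1/2)^n"]) auto
  qed
next
  assume *: "\<forall>x\<in>U. \<exists>e>0. \<forall>y. symb_dist x y < e \<longrightarrow> y \<in> U"
  show "open U"
  proof (rule topological_space_class.openI)
    fix x assume "x \<in> U"
    with * obtain e where e: "e > 0" "\<And>y. symb_dist x y < e \<Longrightarrow> y \<in> U" by blast
    from e(1) obtain n where n: "(1/2) ^ n < e"
      using real_arch_pow_inv[of e "1/2"] by auto
    have "y \<in> U" if "\<forall>i<n. x i = y i" for y
    proof (rule e(2))
      have "symb_dist x y < (1/2) ^ n" using that unfolding symb_dist_less_iff .
      then show "symb_dist x y < e" using n by (rule less_trans)
    qed
    then have "{y. \<forall>i<n. x i = y i} \<subseteq> U" by blast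
    moreover have "x \<in> {y. \<forall>i<n. x i = y i}" by simp
    ultimately show "\<exists>T. open T \<and> x \<in> T \<and> T \<subseteq> U"
      using open_symb_cylinder[of n x] by blast
  qed
qed

lemma compact_symb: "compact (UNIV :: symb set)"
proof -
  have "compact_space (product_topology (\<lambda>_::nat. euclidean :: bool topology) UNIV)"
    unfolding compact_space_product_topology by (simp add: compact_space_def finite_imp_compact)
  then have "compact_space (euclidean :: symb topology)"
    by (simp only: euclidean_product_topology)
  then show ?thesis
    by (simp add: compact_space_def)
qed

lemma continuous_imp_bcontfun:
  fixes f :: "symb \<Rightarrow> real"
  assumes "continuous_on UNIV f"
  shows "f \<in> bcontfun"
  using assms compact_imp_bounded[OF compact_continuous_image[OF assms compact_symb]]
  by (simp add: bcontfun_def)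


section \<open>The Ruelle operator\<close>

text \<open>The concatenation \<open>ax\<close> is \<open>case_nat a x\<close>.\<close>

definition ruelle :: "(symb \<Rightarrow>\<^sub>C real) \<Rightarrow> (symb \<Rightarrow>\<^sub>C real) \<Rightarrow> (symb \<Rightarrow>\<^sub>C real)" where
  "ruelle f \<phi> = Bcontfun (\<lambda>x. \<Sum>a\<in>UNIV. exp (f (case_nat a x)) * \<phi> (case_nat a x))"

lemma continuous_on_case_nat: "continuous_on UNIV (\<lambda>x :: symb. case_nat a x :: symb)"
proof (rule continuous_on_coordinatewise_then_product)
  fix i show "continuous_on UNIV (\<lambda>x :: symb. case_nat a x i)"
    by (cases i) auto
qed

lemma ruelle_apply:
  "ruelle f \<phi> x = (\<Sum>a\<in>UNIV. exp (f (case_nat a x)) * \<phi> (case_nat a x))"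
proof -
  have "continuous_on UNIV (\<lambda>x. \<Sum>a\<in>UNIV. exp (f (case_nat a x)) * \<phi> (case_nat a x))"
    by (intro continuous_intros continuous_on_compose2[OF continuous_on_apply_bcontfun[of UNIV]]
          continuous_on_case_nat) auto
  then show ?thesis
    unfolding ruelle_def by (simp add: Bcontfun_inverse continuous_imp_bcontfun)
qed

lemma bounded_linear_ruelle: "bounded_linear (ruelle f)"
proof (rule bounded_linear_intro[where K = "2 * exp (norm f)"])
  show "ruelle f (\<phi> + \<psi>) = ruelle f \<phi> + ruelle f \<psi>" for \<phi> \<psi>
    by (rule bcontfun_eqI) (simp add: ruelle_apply sum.distrib algebra_simps)
  show "ruelle f (r *\<^sub>R \<phi>) = r *\<^sub>R ruelle f \<phi>" for r \<phi>
    by (rule bcontfun_eqI) (simp add: ruelle_apply sum_distrib_left algebra_simps)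
  show "norm (ruelle f \<phi>) \<le> norm \<phi> * (2 * exp (norm f))" for \<phi>
  proof (rule norm_bound)
    fix x
    have "norm (exp (f (case_nat a x)) * \<phi> (case_nat a x)) \<le> exp (norm f) * norm \<phi>" for a
      using norm_bounded[of f "case_nat a x"] norm_bounded[of \<phi> "case_nat a x"]
      by (auto simp: abs_mult intro!: mult_mono)
    then have "norm (ruelle f \<phi> x) \<le> (\<Sum>a\<in>(UNIV :: bool set). exp (norm f) * norm \<phi>)"
      unfolding ruelle_apply by (intro sum_norm_le)
    then show "norm (ruelle f \<phi> x) \<le> norm \<phi> * (2 * exp (norm f))"
      by (simp add: algebra_simps)
  qed
qed

text \<open>
  The spectrum of a bounded operator \<open>T\<close> on a real Banach space is that of its
  complexification: \<open>(u, v)\<close> stands for \<open>u + \<i> v\<close>, and the operator required to have a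
  bounded inverse is \<open>(u, v) \<mapsto> z (u, v) - (T u, T v)\<close>.
\<close>

definition spectrum :: "('a::real_normed_vector \<Rightarrow> 'a) \<Rightarrow> complex set" where
  "spectrum T = {z. \<not> (\<exists>S. bounded_linear S \<and>
     (let R = (\<lambda>(u, v). (Re z *\<^sub>R u - Im z *\<^sub>R v - T u, Im z *\<^sub>R u + Re z *\<^sub>R v - T v))
      in S \<circ> R = id \<and> R \<circ> S = id))}"

definition spectral_radius :: "('a::real_normed_vector \<Rightarrow> 'a) \<Rightarrow> real" where
  "spectral_radius T = (SUP z\<in>spectrum T. cmod z)"

definition main_eigenvalue :: "(symb \<Rightarrow>\<^sub>C real) \<Rightarrow> real" where
  "main_eigenvalue f = spectral_radius (ruelle f)"

definition positive_main_eigenfunction :: "(symb \<Rightarrow>\<^sub>C real) \<Rightarrow> (symb \<Rightarrow>\<^sub>C real) \<Rightarrow> bool" where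
  "positive_main_eigenfunction f h \<longleftrightarrow>
     (\<forall>x. h x > 0) \<and> ruelle f h = main_eigenvalue f *\<^sub>R h"


section \<open>The Brownian potential\<close>

definition bin_val :: "symb \<Rightarrow> real" where
  "bin_val x = (\<Sum>n. (1/2) ^ Suc n * of_bool (x n))"

locale standard_brownian_motion = prob_space M + complete_measure M
  for M :: "'w measure" and B :: "real \<Rightarrow> 'w \<Rightarrow> real" +
  assumes measurable_B: "s \<in> {0..1} \<Longrightarrow> B s \<in> borel_measurable M"
    and start_zero: "AE \<omega> in M. B 0 \<omega> = 0"
    and independent_increments:
      "\<lbrakk>0 \<le> \<tau> 0; \<And>i. i < n \<Longrightarrow> \<tau> i < \<tau> (Suc i); \<tau> n \<le> 1\<rbrakk> \<Longrightarrow>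
       indep_vars (\<lambda>_. borel) (\<lambda>i \<omega>. B (\<tau> (Suc i)) \<omega> - B (\<tau> i) \<omega>) {..<n}"
    and gaussian_increments:
      "\<lbrakk>0 \<le> s; s < r; r \<le> 1\<rbrakk> \<Longrightarrow>
       distributed M lborel (\<lambda>\<omega>. B r \<omega> - B s \<omega>) (normal_density 0 (sqrt (r - s)))"
    and continuous_paths: "AE \<omega> in M. continuous_on {0..1} (\<lambda>s. B s \<omega>)"

text \<open>Only meaningful for \<open>\<omega>\<close> with a continuous path, that is, almost surely.\<close>

definition brownian_potential :: "(real \<Rightarrow> 'w \<Rightarrow> real) \<Rightarrow> 'w \<Rightarrow> (symb \<Rightarrow>\<^sub>C real)" where
  "brownian_potential B \<omega> = Bcontfun (\<lambda>x. B (bin_val x) \<omega>)"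

lemma summable_bin_val: "summable (\<lambda>n. (1/2 :: real) ^ Suc n * of_bool (x n))"
  by (rule summable_comparison_test'[where g = "\<lambda>n. (1/2) ^ Suc n" and N = 0])
     (auto simp: summable_geometric)

lemma bin_val_in_unit: "bin_val x \<in> {0..1}"
proof -
  have "bin_val x \<le> (\<Sum>n. (1/2) ^ Suc n)"
    unfolding bin_val_def by (intro suminf_le summable_bin_val) (auto simp: summable_geometric)
  also have "\<dots> = 1"
    using power_half_series by (simp add: sums_iff)
  finally have "bin_val x \<le> 1" .
  moreover have "0 \<le> bin_val x"
    unfolding bin_val_def by (intro suminf_nonneg summable_bin_val) simp
  ultimately show ?thesis by simp
qed

lemma continuous_on_bin_val: "continuous_on UNIV bin_val"
proof -
  have "uniform_limit UNIV (\<lambda>n x. \<Sum>i<n. (1/2 :: real) ^ Suc i * of_bool (x i))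
          (\<lambda>x. \<Sum>i. (1/2) ^ Suc i * of_bool (x i)) sequentially"
    by (rule Weierstrass_m_test[where M = "\<lambda>n. (1/2) ^ Suc n"]) (auto simp: summable_geometric)
  moreover have "continuous_on UNIV (\<lambda>x :: symb. of_bool (x i) :: real)" for i
    by (rule continuous_on_compose2[where g = "of_bool" and t = UNIV])
       (auto intro: continuous_on_discrete)
  ultimately have "continuous_on UNIV (\<lambda>x :: symb. \<Sum>i. (1/2 :: real) ^ Suc i * of_bool (x i))"
    by (intro uniform_limit_theorem[where F = sequentially])
       (auto intro!: always_eventually continuous_intros)
  then show ?thesis
    by (simp add: bin_val_def[abs_def])
qed

lemma brownian_potential_apply:
  assumes "continuous_on {0..1} (\<lambda>s. B s \<omega>)"
  shows "brownian_potential B \<omega> x = B (bin_val x) \<omega>"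
proof -
  have "continuous_on UNIV (\<lambda>x. B (bin_val x) \<omega>)"
    by (rule continuous_on_compose2[OF assms continuous_on_bin_val]) (use bin_val_in_unit in auto)
  then show ?thesis
    unfolding brownian_potential_def by (simp add: Bcontfun_inverse continuous_imp_bcontfun)
qed


section \<open>The path space and the bijection onto the continuous functions\<close>

definition double_pts :: "real set" where
  "double_pts = {s \<in> {0..1}. card (bin_val -` {s}) = 2}"

text \<open>
  Functions on \<open>[0,1]\<close> are total functions whose values outside \<open>[0,1]\<close> are ignored.
  The one-sided limits are only taken at points of \<open>double_pts\<close>, which are interior to
  \<open>[0,1]\<close> because 0 and 1 have only one binary expansion.
\<close>

definition path_space :: "(real \<Rightarrow> real) set" where
  "path_space = {F.
     (\<forall>s\<in>{0..1} - double_pts. continuous (at s within {0..1}) F) \<and>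
     (\<forall>s\<in>double_pts. (\<exists>l. (F \<longlongrightarrow> l) (at_left s)) \<and> (F \<longlongrightarrow> F s) (at_right s))}"

definition Theta :: "(real \<Rightarrow> real) \<Rightarrow> symb \<Rightarrow> real" where
  "Theta F x =
     (if bin_val x \<in> double_pts \<and> (\<exists>y. bin_val y = bin_val x \<and> less_fun x y)
      then Lim (at_left (bin_val x)) F
      else F (bin_val x))"

end

theory Submission
  imports Defs
begin

text \<open>
  Evaluate the eigenvalue equation at \<open>(0,0,\<dots>)\<close>. The two preimages \<open>(0,0,0,\<dots>)\<close> and
  \<open>(1,0,0,\<dots>)\<close> have binary values \<open>0\<close> and \<open>1/2\<close>, and each is the lexicographically largest
  expansion of its value, so that \<open>\<Theta>\<close> evaluates \<open>X\<close> itself there rather than a left limit.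
\<close>

text \<open>Here \<open><\<close> is the digitwise order: the difference of the two series has
  nonnegative terms and at least one positive term. For the lexicographic order strictness fails at
  double expansions.\<close>

lemma bin_val_strict_mono:
  assumes "x < y"
  shows "bin_val x < bin_val y"
proof -
  let ?d = "\<lambda>n. (1/2 :: real) ^ Suc n * of_bool (y n) - (1/2) ^ Suc n * of_bool (x n)"
  from assms obtain i where "\<not> x i" "y i"
    by (auto simp: less_le_not_le le_fun_def)
  moreover have "x n \<le> y n" for n
    using assms by (simp add: less_le_not_le le_fun_def)
  ultimately have "0 < suminf ?d"
    by (intro suminf_pos2[where i = i] summable_diff summable_bin_val) (auto simp: le_bool_def)
  also have "suminf ?d = bin_val y - bin_val x"
    unfolding bin_val_def by (intro suminf_diff[symmetric] summable_bin_val)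
  finally show ?thesis by simp
qed

lemma bin_val_case_nat: "bin_val (case_nat a x) = (of_bool a + bin_val x) / 2"
proof -
  have "(\<Sum>n. (1/2 :: real) ^ Suc (Suc n) * of_bool (x n)) = bin_val x / 2"
    unfolding bin_val_def using suminf_divide[OF summable_bin_val, of x 2] by simp
  then show ?thesis
    using suminf_split_head[OF summable_bin_val, of "case_nat a x"]
    by (simp add: bin_val_def field_simps)
qed

lemma bin_val_bot: "bin_val bot = 0"
  by (simp add: bin_val_def)

lemma Theta_case_nat_bot: "Theta F (case_nat a bot) = F (of_bool a / 2)"
proof -
  have "\<not> (bin_val y = bin_val (case_nat a bot) \<and> less_fun (case_nat a bot) y)" for y
  proof
    assume *: "bin_val y = bin_val (case_nat a bot) \<and> less_fun (case_nat a bot) y"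
    then obtain k where k: "case_nat a bot k < y k" "\<forall>k'<k. case_nat a bot k' = y k'"
      by (auto simp: less_fun_def)
    \<comment> \<open>Lexicographic order becomes digitwise here: before \<open>k\<close> the digits
      agree, and at a positive index the left digit is 0.\<close>
    have "case_nat a bot i \<le> y i" for i
      using k by (cases "i = k"; cases i; cases k) auto
    moreover have "case_nat a bot \<noteq> y"
      using k by auto
    ultimately have "case_nat a bot < y"
      by (simp add: le_fun_def less_le)
    then show False
      using bin_val_strict_mono * by fastforce
  qed
  then have "Theta F (case_nat a bot) = F (bin_val (case_nat a bot))"
    unfolding Theta_def by auto
  then show ?thesis
    by (simp add: bin_val_case_nat bin_val_bot)
qed

text \<open>The zero sequence is its own preimage, so \<open>h\<close> at \<open>bot\<close> occurs
  on both sides of the eigenvalue equation.\<close>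

lemma case_nat_False_bot: "case_nat False bot = (bot :: symb)"
  by (auto simp: fun_eq_iff split: nat.split)

theorem mainTheorem3:
  fixes M :: "'w measure"
    and B :: "real \<Rightarrow> 'w \<Rightarrow> real"
    and h :: "'w \<Rightarrow> (symb \<Rightarrow>\<^sub>C real)"
    and X :: "real \<Rightarrow> 'w \<Rightarrow> real"
  assumes "standard_brownian_motion M B"
    and "AE \<omega> in M. positive_main_eigenfunction (brownian_potential B \<omega>) (h \<omega>)"
    and "AE \<omega> in M. (\<lambda>s. X s \<omega>) \<in> path_space \<and> Theta (\<lambda>s. X s \<omega>) = apply_bcontfun (h \<omega>)"
  shows "AE \<omega> in M. main_eigenvalue (brownian_potential B \<omega>)
           = 1 + exp (B (1/2) \<omega>) * (X (1/2) \<omega> / X 0 \<omega>)"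
proof -
  interpret standard_brownian_motion M B by fact
  show ?thesis
    using assms(2,3) start_zero continuous_paths
  proof eventually_elim
    case (elim \<omega>)
    let ?f = "brownian_potential B \<omega>"
    have h: "h \<omega> (case_nat a bot) = X (of_bool a / 2) \<omega>" for a
      using Theta_case_nat_bot[of "\<lambda>s. X s \<omega>" a] elim(2) by simp
    \<comment> \<open>Path continuity ensures that \<open>Bcontfun\<close> returns the intended
      function.\<close>
    have f: "?f (case_nat a bot) = B (of_bool a / 2) \<omega>" for a
      by (simp add: brownian_potential_apply[where B = B, OF elim(4)] bin_val_case_nat bin_val_bot)
    have "h \<omega> bot = X 0 \<omega>"
      using h[of False] by (simp add: case_nat_False_bot)
    moreover have "h \<omega> bot > 0" "ruelle ?f (h \<omega>) bot = main_eigenvalue ?f * h \<omega> bot"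
      using elim(1) by (auto simp: positive_main_eigenfunction_def)
    ultimately have "X 0 \<omega> > 0"
        "main_eigenvalue ?f * X 0 \<omega> = X 0 \<omega> + exp (B (1/2) \<omega>) * X (1/2) \<omega>"
      \<comment> \<open>As \<open>B 0 \<omega> = 0\<close>, the preimage \<open>bot\<close> has
        weight \<open>exp 0 = 1\<close>, the source of the summand 1 after division by
        \<open>X 0 \<omega>\<close>.\<close>
      using elim(3) by (simp_all add: ruelle_apply UNIV_bool h f)
    then show ?case
      by (simp add: field_simps)
  qed
qed

end
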